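(* Let $S$ be a finite set, let $\mathcal P=(p_{xy})_{x,y\in S}$ be a stochastic matrix with $\min_{x,y\in S}p_{xy}>0$, let $(X_n)_{n\ge0}$ be the homogeneous Markov chain on $S$ with transition matrix $\mathcal P$, and let $\mu$ be its unique invariant probability measure. Let $c_1:S\to\mathbb R$ satisfy $$\bar c_1:=\sum_{x\in S}c_1(x)\mu(x)>0 .$$ Then there exists $\varepsilon_0>0$ such that for every $0<\varepsilon<\varepsilon_0$, with $c:=\varepsilon c_1$, and for every function $f:S\to\mathbb R$, the series $$u(x)=\sum_{n=0}^\infty \mathbb E_x\left[\exp\left(-\sum_{k=0}^{n-1}c(X_k)\right) f(X_n)\right]$$ converges absolutely for every $x\in S$, the function $u$ satisfies $$\exp(-c(x))\,\mathcal Pu(x)-u(x)=-f(x),\qquad x\in S,$$ and $u$ is the only function $S\to\mathbb R$ satisfying this equation.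
   Context: $\mathbb E_x$ denotes expectation for the chain started at the non-random state $X_0=x$. $\mathcal Pu(x)=\sum_{y\in S}p_{xy}u(y)=\mathbb E_xu(X_1)$. An empty sum ($\sum_{k=0}^{-1}$) equals $0$. *)

theory Defs
  imports "HOL-Probability.Probability"
begin

definition stochastic_matrix :: "('s::finite \<Rightarrow> 's \<Rightarrow> real) \<Rightarrow> bool" where
  "stochastic_matrix p \<longleftrightarrow> (\<forall>x y. 0 \<le> p x y) \<and> (\<forall>x. (\<Sum>y\<in>UNIV. p x y) = 1)"

definition invariant_distribution :: "('s::finite \<Rightarrow> 's \<Rightarrow> real) \<Rightarrow> 's pmf \<Rightarrow> bool" where
  "invariant_distribution p \<mu> \<longleftrightarrow> (\<forall>y. (\<Sum>x\<in>UNIV. pmf \<mu> x * p x y) = pmf \<mu> y)"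

text \<open>
  The process \<open>X\<close> is, under the probability measure \<open>M\<close>, a homogeneous Markov chain with
  transition matrix \<open>p\<close> started at the non-random state \<open>x\<close>. Conditioning is only on histories
  of positive probability.
\<close>
definition markov_chain_from ::
  "('s::finite \<Rightarrow> 's \<Rightarrow> real) \<Rightarrow> 's \<Rightarrow> 'w measure \<Rightarrow> (nat \<Rightarrow> 'w \<Rightarrow> 's) \<Rightarrow> bool" where
  "markov_chain_from p x M X \<longleftrightarrow>
     prob_space M \<and>
     (\<forall>n. X n \<in> measurable M (count_space UNIV)) \<and>
     (AE \<omega> in M. X 0 \<omega> = x) \<and>
     (\<forall>n h y. \<P>(\<omega> in M. \<forall>k\<le>n. X k \<omega> = h k) > 0 \<longrightarrow>
        \<P>(\<omega> in M. X (Suc n) \<omega> = y \<bar> \<forall>k\<le>n. X k \<omega> = h k) = p (h n) y)"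

definition transition_operator ::
  "('s::finite \<Rightarrow> 's \<Rightarrow> real) \<Rightarrow> ('s \<Rightarrow> real) \<Rightarrow> 's \<Rightarrow> real" where
  "transition_operator p u x = (\<Sum>y\<in>UNIV. p x y * u y)"

text \<open>
  The measure \<open>P x\<close> is the law under which the chain starts at \<open>x\<close>, so that integration with
  respect to it is the expectation started at \<open>x\<close>.
\<close>
definition feynman_kac_term ::
  "('s \<Rightarrow> 'w measure) \<Rightarrow> (nat \<Rightarrow> 'w \<Rightarrow> 's) \<Rightarrow> ('s \<Rightarrow> real) \<Rightarrow> ('s \<Rightarrow> real) \<Rightarrow> 's \<Rightarrow> nat \<Rightarrow> real" where
  "feynman_kac_term P X c f x n =
     (\<integral>\<omega>. exp (- (\<Sum>k<n. c (X k \<omega>))) * f (X n \<omega>) \<partial>P x)"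

end

theory Submission
  imports Defs
begin

text \<open>
  Write \<open>T\<close> for the operator \<open>g \<mapsto> exp (- c) \<cdot> \<P>g\<close>. The Markov property turns the \<open>n\<close>-th
  Feynman--Kac term into \<open>T\<^sup>n f\<close>, so \<open>u\<close> is the Neumann series of \<open>T\<close> and the equation says
  \<open>u = f + T u\<close>. Since \<open>c\<close> may take negative values, \<open>T\<close> need not contract the sup norm; but
  it is given by a nonnegative kernel, so it is enough to find a positive function \<open>w\<close> with
  \<open>T w < w\<close> pointwise: then \<open>T\<close> contracts the sup norm weighted by \<open>w\<close>
  (lemma \<open>neumann_series\<close>).

  To find \<open>w\<close>, let \<open>h\<close> solve the Poisson equation \<open>\<P>h - h = c\<^sub>1 - m\<close>, where \<open>m > 0\<close> is the
  \<open>\<mu>\<close>-mean of \<open>c\<^sub>1\<close>, and put \<open>w = exp (\<epsilon> h)\<close>. Then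
  \<open>T w - w = \<epsilon> (- c\<^sub>1 + \<P>h - h) + O(\<epsilon>\<^sup>2) = - \<epsilon> m + O(\<epsilon>\<^sup>2)\<close>, which is negative for small \<open>\<epsilon> > 0\<close>
  (lemma \<open>exists_strict_supersolution\<close>).

  The Poisson equation is itself solved by \<open>neumann_series\<close>. By Doeblin's minorization
  \<open>p x y \<ge> \<delta> \<ge> \<delta> \<mu>(y)\<close>, the kernel \<open>p x y - \<delta> \<mu>(y)\<close> is nonnegative with row sums
  \<open>1 - \<delta> < 1\<close>, and it acts like \<open>p\<close> on functions of \<open>\<mu>\<close>-mean zero
  (lemma \<open>poisson_equation\<close>).
\<close>

section \<open>Neumann series of nonnegative kernels\<close>

lemma transition_operator_mono:
  assumes "\<And>x y. 0 \<le> a x y" and "\<And>y. f y \<le> g y"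
  shows "transition_operator a f x \<le> transition_operator a g x"
  unfolding transition_operator_def by (intro sum_mono mult_left_mono assms)

lemma abs_transition_operator_le:
  assumes "\<And>x y. 0 \<le> a x y"
  shows "\<bar>transition_operator a f x\<bar> \<le> transition_operator a (\<lambda>y. \<bar>f y\<bar>) x"
  unfolding transition_operator_def
  by (rule order_trans[OF sum_abs]) (simp add: abs_mult assms)

lemma transition_operator_scale:
  "transition_operator a (\<lambda>y. k * f y) x = k * transition_operator a f x"
  unfolding transition_operator_def by (simp add: sum_distrib_left mult.left_commute)

lemma transition_operator_diff:
  "transition_operator a (\<lambda>y. f y - g y) x = transition_operator a f x - transition_operator a g x"
  unfolding transition_operator_def by (simp add: right_diff_distrib sum_subtractf)

text \<open>
  Finiteness of the state space makes the strict pointwise inequality uniform, with the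
  contraction factor \<open>l\<close> the largest ratio of the two sides.
\<close>
lemma uniform_contraction_factor:
  fixes a :: "'s::finite \<Rightarrow> 's \<Rightarrow> real"
  assumes nonneg: "\<And>x y. 0 \<le> a x y" and pos: "\<And>x. 0 < w x"
    and strict: "\<And>x. transition_operator a w x < w x"
  obtains l where "0 \<le> l" "l < 1" "\<And>x. transition_operator a w x \<le> l * w x"
proof
  define r where "r = (\<lambda>x. transition_operator a w x / w x)"
  have le: "r x \<le> Max (range r)" for x
    by (rule Max_ge) auto
  have "0 \<le> r x" for x
    unfolding r_def transition_operator_def
    by (intro divide_nonneg_pos sum_nonneg mult_nonneg_nonneg nonneg pos less_imp_le[OF pos])
  then show "0 \<le> Max (range r)"
    using le order_trans by blast
  have "r x < 1" for x
    using strict pos unfolding r_def by simp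
  then show "Max (range r) < 1"
    by (subst Max_less_iff) auto
  show "transition_operator a w x \<le> Max (range r) * w x" for x
    using mult_right_mono[OF le[of x] less_imp_le[OF pos[of x]]] pos[of x]
    by (simp add: r_def)
qed

lemma bounded_by_positive_weight:
  fixes f w :: "'s::finite \<Rightarrow> real"
  assumes pos: "\<And>x. 0 < w x"
  obtains K where "0 \<le> K" "\<And>x. \<bar>f x\<bar> \<le> K * w x"
proof
  define r where "r = (\<lambda>x. \<bar>f x\<bar> / w x)"
  have le: "r x \<le> Max (range r)" for x
    by (rule Max_ge) auto
  have "0 \<le> r x" for x
    unfolding r_def by (intro divide_nonneg_pos abs_ge_zero pos)
  then show "0 \<le> Max (range r)"
    using le order_trans by blast
  show "\<bar>f x\<bar> \<le> Max (range r) * w x" for x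
    using mult_right_mono[OF le[of x] less_imp_le[OF pos[of x]]] pos[of x]
    by (simp add: r_def)
qed

lemma abs_iterate_le:
  assumes nonneg: "\<And>x y. 0 \<le> a x y" and l: "0 \<le> l"
    and contr: "\<And>x. transition_operator a w x \<le> l * w x"
    and K: "0 \<le> K" "\<And>x. \<bar>f x\<bar> \<le> K * w x"
  shows "\<bar>(transition_operator a ^^ n) f x\<bar> \<le> K * l ^ n * w x"
proof (induction n arbitrary: x)
  case 0
  then show ?case using K by simp
next
  case (Suc n)
  have "\<bar>(transition_operator a ^^ Suc n) f x\<bar>
      \<le> transition_operator a (\<lambda>y. \<bar>(transition_operator a ^^ n) f y\<bar>) x"
    using abs_transition_operator_le[OF nonneg] by simp
  also have "\<dots> \<le> transition_operator a (\<lambda>y. K * l ^ n * w y) x"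
    by (intro transition_operator_mono nonneg Suc)
  also have "\<dots> \<le> K * l ^ n * (l * w x)"
    unfolding transition_operator_scale by (intro mult_left_mono contr) (simp add: K l)
  finally show ?case by (simp add: mult_ac)
qed

text \<open>
  The iterates decay geometrically in the sup norm weighted by \<open>w\<close>. This gives convergence,
  and also uniqueness: the difference of two solutions is a fixed point, hence equal to all of
  its own iterates.
\<close>
lemma neumann_series:
  fixes a :: "'s::finite \<Rightarrow> 's \<Rightarrow> real"
  assumes nonneg: "\<And>x y. 0 \<le> a x y" and pos: "\<And>x. 0 < w x"
    and strict: "\<And>x. transition_operator a w x < w x"
  defines "u \<equiv> \<lambda>f x. \<Sum>n. (transition_operator a ^^ n) f x"
  shows neumann_series_summable: "summable (\<lambda>n. \<bar>(transition_operator a ^^ n) f x\<bar>)"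
    and neumann_series_solution: "u f x = f x + transition_operator a (u f) x"
    and neumann_series_unique: "(\<And>x. v x = f x + transition_operator a v x) \<Longrightarrow> v = u f"
proof -
  obtain l where l: "0 \<le> l" "l < 1" "\<And>x. transition_operator a w x \<le> l * w x"
    by (rule uniform_contraction_factor[OF nonneg pos strict]) (rule that)
  have abs_summable: "summable (\<lambda>n. \<bar>(transition_operator a ^^ n) f x\<bar>)" for f x
  proof -
    obtain K where K: "0 \<le> K" "\<And>x. \<bar>f x\<bar> \<le> K * w x"
      by (rule bounded_by_positive_weight[OF pos]) (rule that)
    have "summable (\<lambda>n. K * l ^ n * w x)"
      using l by (intro summable_mult summable_mult2 summable_geometric) simp
    then show ?thesis
      using abs_iterate_le[OF nonneg l(1,3) K] by (auto intro: summable_comparison_test')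
  qed
  then show "summable (\<lambda>n. \<bar>(transition_operator a ^^ n) f x\<bar>)" .
  have summable: "summable (\<lambda>n. (transition_operator a ^^ n) f x)" for f x
    using abs_summable by (rule summable_rabs_cancel)
  have solution: "u f x = f x + transition_operator a (u f) x" for x
  proof -
    have "transition_operator a (u f) x
        = (\<Sum>y\<in>UNIV. \<Sum>n. a x y * (transition_operator a ^^ n) f y)"
      unfolding transition_operator_def[of a "u f"] by (simp add: u_def suminf_mult summable)
    also have "\<dots> = (\<Sum>n. (transition_operator a ^^ Suc n) f x)"
      by (subst suminf_sum[symmetric])
        (auto simp: transition_operator_def[of a "(transition_operator a ^^ _) f"]
          intro: summable_mult summable)
    also have "\<dots> = u f x - f x"
      unfolding u_def using suminf_split_head[OF summable, of f x] by simp
    finally show ?thesis by simp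
  qed
  then show "u f x = f x + transition_operator a (u f) x" .
  show "v = u f" if v: "\<And>x. v x = f x + transition_operator a v x"
  proof
    fix x
    define d where "d = (\<lambda>x. v x - u f x)"
    have "transition_operator a d = d"
    proof
      show "transition_operator a d x = d x" for x
        unfolding d_def transition_operator_diff using v[of x] solution[of x] by simp
    qed
    then have "(transition_operator a ^^ n) d = d" for n
      by (induction n) auto
    with summable[of d x] have "summable (\<lambda>n::nat. d x)"
      by simp
    then have "d x = 0"
      by (simp add: summable_const_iff)
    then show "v x = u f x"
      unfolding d_def by simp
  qed
qed

section \<open>The Poisson equation\<close>

lemma pmf_sum_UNIV: "(\<Sum>x\<in>UNIV. pmf \<mu> (x :: 's::finite)) = 1"
  by (rule sum_pmf_eq_1) auto

lemma invariant_mean: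
  assumes "invariant_distribution p \<mu>"
  shows "(\<Sum>x\<in>UNIV. pmf \<mu> x * transition_operator p h x) = (\<Sum>x\<in>UNIV. pmf \<mu> x * h x)"
proof -
  have "(\<Sum>x\<in>UNIV. pmf \<mu> x * transition_operator p h x)
      = (\<Sum>y\<in>UNIV. (\<Sum>x\<in>UNIV. pmf \<mu> x * p x y) * h y)"
    unfolding transition_operator_def
    by (simp add: sum_distrib_left sum_distrib_right mult.assoc) (rule sum.swap)
  then show ?thesis
    using assms unfolding invariant_distribution_def by simp
qed

text \<open>
  A solution \<open>h\<close> of the equation for the kernel \<open>p x y - \<delta> \<mu>(y)\<close> solves the Poisson equation up
  to the constant \<open>\<delta> \<mu>(h)\<close>; integrating against the invariant \<open>\<mu>\<close> shows that the constant
  vanishes.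
\<close>
lemma poisson_equation:
  fixes p :: "'s::finite \<Rightarrow> 's \<Rightarrow> real"
  assumes stoch: "stochastic_matrix p" and inv: "invariant_distribution p \<mu>"
    and \<delta>: "0 < \<delta>" "\<And>x y. \<delta> \<le> p x y"
    and mean_zero: "(\<Sum>x\<in>UNIV. pmf \<mu> x * g x) = 0"
  obtains h where "\<And>x. transition_operator p h x - h x = g x"
proof -
  define r where "r x y = p x y - \<delta> * pmf \<mu> y" for x y
  define mean where "mean h = (\<Sum>x\<in>UNIV. pmf \<mu> x * h x)" for h
  have r_eq: "transition_operator r h x = transition_operator p h x - \<delta> * mean h" for h x
    unfolding transition_operator_def r_def mean_def
    by (simp add: left_diff_distrib sum_subtractf sum_distrib_left mult.assoc)
  have "\<delta> * pmf \<mu> y \<le> p x y" for x y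
    by (rule order_trans[OF mult_left_le \<delta>(2)]) (use \<delta>(1) in \<open>auto intro: pmf_le_1\<close>)
  then have nonneg: "0 \<le> r x y" for x y
    unfolding r_def by simp
  have strict: "transition_operator r (\<lambda>_. 1) x < 1" for x
    unfolding r_eq using stoch \<delta>(1)
    by (simp add: transition_operator_def mean_def pmf_sum_UNIV stochastic_matrix_def)
  define h where "h = (\<lambda>x. \<Sum>n. (transition_operator r ^^ n) (\<lambda>x. - g x) x)"
  have "h x = - g x + transition_operator r h x" for x
    unfolding h_def by (rule neumann_series_solution[where w = "\<lambda>_. 1"]) (auto intro: nonneg strict)
  from this[unfolded r_eq]
  have h: "transition_operator p h x - h x = g x + \<delta> * mean h" for x
    by (simp add: algebra_simps)
  have "0 = (\<Sum>x\<in>UNIV. pmf \<mu> x * (transition_operator p h x - h x))"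
    by (simp add: right_diff_distrib sum_subtractf invariant_mean[OF inv])
  also have "\<dots> = (\<Sum>x\<in>UNIV. pmf \<mu> x * g x) + (\<Sum>x\<in>UNIV. pmf \<mu> x) * (\<delta> * mean h)"
    by (simp only: h distrib_left sum.distrib sum_distrib_right)
  also have "\<dots> = \<delta> * mean h"
    by (simp add: mean_zero pmf_sum_UNIV)
  finally have "transition_operator p h x - h x = g x" for x
    using h by simp
  then show ?thesis
    by (rule that)
qed

section \<open>A strict supersolution for small potentials\<close>

definition tilted_kernel :: "('s \<Rightarrow> real) \<Rightarrow> ('s \<Rightarrow> 's \<Rightarrow> real) \<Rightarrow> 's \<Rightarrow> 's \<Rightarrow> real" where
  "tilted_kernel c p x y = exp (- c x) * p x y"

lemma transition_operator_tilted_kernel: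
  "transition_operator (tilted_kernel c p) f x = exp (- c x) * transition_operator p f x"
  unfolding transition_operator_def tilted_kernel_def by (simp add: sum_distrib_left mult.assoc)

text \<open>
  At \<open>\<epsilon> = 0\<close> both sides of the inequality are \<open>1\<close>, and the derivative of their difference is
  \<open>\<P>h - h - c\<^sub>1\<close>, which the Poisson equation makes equal to minus the mean of \<open>c\<^sub>1\<close>.
\<close>
lemma exists_strict_supersolution:
  fixes p :: "'s::finite \<Rightarrow> 's \<Rightarrow> real"
  assumes stoch: "stochastic_matrix p" and inv: "invariant_distribution p \<mu>"
    and \<delta>: "0 < \<delta>" "\<And>x y. \<delta> \<le> p x y"
    and mean_pos: "0 < (\<Sum>x\<in>UNIV. c1 x * pmf \<mu> x)"
  obtains h \<epsilon>0 where "0 < \<epsilon>0" and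
    "\<And>\<epsilon> x. 0 < \<epsilon> \<Longrightarrow> \<epsilon> < \<epsilon>0 \<Longrightarrow>
      transition_operator (tilted_kernel (\<lambda>x. \<epsilon> * c1 x) p) (\<lambda>y. exp (\<epsilon> * h y)) x < exp (\<epsilon> * h x)"
proof -
  define m where "m = (\<Sum>x\<in>UNIV. c1 x * pmf \<mu> x)"
  have "(\<Sum>x\<in>UNIV. pmf \<mu> x * (c1 x - m)) = m - (\<Sum>x\<in>UNIV. pmf \<mu> x) * m"
    unfolding m_def sum_distrib_right by (simp add: algebra_simps sum_subtractf)
  then have "(\<Sum>x\<in>UNIV. pmf \<mu> x * (c1 x - m)) = 0"
    by (simp add: pmf_sum_UNIV)
  then obtain h where h: "\<And>x. transition_operator p h x - h x = c1 x - m"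
    by (rule poisson_equation[OF stoch inv \<delta>]) (rule that)
  define F where "F x \<epsilon> = exp (- (\<epsilon> * c1 x)) * (\<Sum>y\<in>UNIV. p x y * exp (\<epsilon> * h y)) - exp (\<epsilon> * h x)"
    for x \<epsilon>
  have row: "(\<Sum>y\<in>UNIV. p x y) = 1" for x
    using stoch unfolding stochastic_matrix_def by simp
  have F0: "F x 0 = 0" for x
    unfolding F_def by (simp add: row)
  have "(F x has_real_derivative - c1 x + (\<Sum>y\<in>UNIV. p x y * h y) - h x) (at 0)" for x
    unfolding F_def[abs_def] by (auto intro!: derivative_eq_intros simp: row mult.commute)
  moreover have "- c1 x + (\<Sum>y\<in>UNIV. p x y * h y) - h x = - m" for x
    using h[of x] unfolding transition_operator_def by simp
  ultimately have "(F x has_real_derivative - m) (at 0)" for x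
    by simp
  then have "\<exists>d>0. \<forall>\<epsilon>>0. \<epsilon> < d \<longrightarrow> F x \<epsilon> < 0" for x
    using DERIV_neg_dec_right[of "F x" "- m" 0] mean_pos F0 unfolding m_def by simp
  then obtain d where d: "\<And>x. 0 < d x" "\<And>x \<epsilon>. 0 < \<epsilon> \<Longrightarrow> \<epsilon> < d x \<Longrightarrow> F x \<epsilon> < 0"
    by metis
  show thesis
  proof
    show "0 < Min (range d)"
      using d(1) by simp
    show "transition_operator (tilted_kernel (\<lambda>x. \<epsilon> * c1 x) p) (\<lambda>y. exp (\<epsilon> * h y)) x
        < exp (\<epsilon> * h x)" if "0 < \<epsilon>" "\<epsilon> < Min (range d)" for \<epsilon> x
    proof -
      have "\<epsilon> < d x"
        using that(2) by simp
      then show ?thesis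
        using d(2)[OF that(1)] unfolding F_def transition_operator_tilted_kernel
        by (simp add: transition_operator_def)
    qed
  qed
qed

section \<open>The Feynman--Kac terms as iterates\<close>

text \<open>
  Multiplying out the conditional probability gives an identity that also holds for histories of
  probability zero.
\<close>
lemma markov_chain_from_history:
  assumes "markov_chain_from p x M X"
  shows "measure M {\<omega>\<in>space M. (\<forall>k\<le>n. X k \<omega> = h k) \<and> X (Suc n) \<omega> = y}
    = measure M {\<omega>\<in>space M. \<forall>k\<le>n. X k \<omega> = h k} * p (h n) y"
proof -
  interpret prob_space M
    using assms unfolding markov_chain_from_def by simp
  have [measurable]: "X k \<in> measurable M (count_space UNIV)" for k
    using assms unfolding markov_chain_from_def by simp
  let ?A = "{\<omega>\<in>space M. \<forall>k\<le>n. X k \<omega> = h k}"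
  let ?B = "{\<omega>\<in>space M. (\<forall>k\<le>n. X k \<omega> = h k) \<and> X (Suc n) \<omega> = y}"
  show ?thesis
  proof (cases "measure M ?A = 0")
    case True
    have "measure M ?B \<le> measure M ?A"
      by (rule finite_measure_mono) auto
    then show ?thesis
      using True by (simp add: measure_le_0_iff)
  next
    case False
    then have "0 < measure M ?A"
      by (simp add: zero_less_measure_iff)
    then have "\<P>(\<omega> in M. X (Suc n) \<omega> = y \<bar> \<forall>k\<le>n. X k \<omega> = h k) = p (h n) y"
      using assms unfolding markov_chain_from_def by blast
    then show ?thesis
      using False unfolding cond_prob_def by (simp add: field_simps conj_commute)
  qed
qed

text \<open>
  The Markov property in the form \<open>E[g \<cdot> f(X\<^sub>n\<^sub>+\<^sub>1)] = E[g \<cdot> \<P>f(X\<^sub>n)]\<close> for \<open>g\<close> a function of the history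
  up to time \<open>n\<close>. There are finitely many histories, encoded as the extensional functions on
  \<open>{..n}\<close>, so both expectations are finite sums over them.
\<close>
lemma markov_property:
  fixes p :: "'s::finite \<Rightarrow> 's \<Rightarrow> real"
  assumes mc: "markov_chain_from p x M X"
    and dep: "\<And>h h'. (\<And>k. k \<le> n \<Longrightarrow> h k = h' k) \<Longrightarrow> g h = g h'"
  shows "(\<integral>\<omega>. g (\<lambda>k. X k \<omega>) * f (X (Suc n) \<omega>) \<partial>M)
    = (\<integral>\<omega>. g (\<lambda>k. X k \<omega>) * transition_operator p f (X n \<omega>) \<partial>M)"
proof -
  interpret prob_space M
    using mc unfolding markov_chain_from_def by simp
  have [measurable]: "X k \<in> measurable M (count_space UNIV)" for k
    using mc unfolding markov_chain_from_def by simp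
  define H where "H = (PiE {..n} (\<lambda>_. UNIV) :: (nat \<Rightarrow> 's) set)"
  define A where "A h = {\<omega>\<in>space M. \<forall>k\<le>n. X k \<omega> = h k}" for h
  define B where "B h y = {\<omega>\<in>space M. (\<forall>k\<le>n. X k \<omega> = h k) \<and> X (Suc n) \<omega> = y}" for h y
  have events: "A h \<in> sets M" "B h y \<in> sets M" for h y
    unfolding A_def B_def by measurable
  have indicator_integral: "integrable M (\<lambda>\<omega>. indicator E \<omega> * k)"
    "(\<integral>\<omega>. indicator E \<omega> * k \<partial>M) = measure M E * k" if "E \<in> sets M" for E and k :: real
    using that by (auto simp: emeasure_eq_measure)
  have finH: "finite H"
    unfolding H_def by (intro finite_PiE) auto
  have sum_history: "(\<Sum>h\<in>H. indicator (A h) \<omega> * (F h :: real)) = F (restrict (\<lambda>k. X k \<omega>) {..n})"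
    if "\<omega> \<in> space M" for \<omega> F
  proof -
    have "indicator (A h) \<omega> * F h = (if h = restrict (\<lambda>k. X k \<omega>) {..n} then F h else 0)"
      if "h \<in> H" for h
    proof -
      have "\<omega> \<in> A h \<longleftrightarrow> h = restrict (\<lambda>k. X k \<omega>) {..n}"
        using \<open>\<omega> \<in> space M\<close> that
        unfolding A_def H_def by (auto simp: PiE_def extensional_def fun_eq_iff)
      then show ?thesis
        by (simp add: indicator_def)
    qed
    then have "(\<Sum>h\<in>H. indicator (A h) \<omega> * F h)
        = (\<Sum>h\<in>H. if h = restrict (\<lambda>k. X k \<omega>) {..n} then F h else 0)"
      by (rule sum.cong[OF refl])
    also have "\<dots> = F (restrict (\<lambda>k. X k \<omega>) {..n})"
      using finH by (simp add: H_def)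
    finally show ?thesis .
  qed
  have g_restrict: "g (restrict (\<lambda>k. X k \<omega>) {..n}) = g (\<lambda>k. X k \<omega>)" for \<omega>
    by (rule dep) simp
  have "(\<integral>\<omega>. g (\<lambda>k. X k \<omega>) * f (X (Suc n) \<omega>) \<partial>M)
      = (\<integral>\<omega>. (\<Sum>h\<in>H. \<Sum>y\<in>UNIV. indicator (B h y) \<omega> * (g h * f y)) \<partial>M)"
  proof (rule Bochner_Integration.integral_cong[OF refl])
    fix \<omega> assume \<omega>: "\<omega> \<in> space M"
    have "(\<Sum>y\<in>UNIV. indicator (B h y) \<omega> * (g h * f y))
        = indicator (A h) \<omega> * (g h * f (X (Suc n) \<omega>))" for h
    proof -
      have "indicator (B h y) \<omega> * (g h * f y)
          = (if y = X (Suc n) \<omega> then indicator (A h) \<omega> * (g h * f y) else 0)" for y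
        unfolding A_def B_def by (auto simp: indicator_def)
      then show ?thesis
        by simp
    qed
    then show "g (\<lambda>k. X k \<omega>) * f (X (Suc n) \<omega>)
        = (\<Sum>h\<in>H. \<Sum>y\<in>UNIV. indicator (B h y) \<omega> * (g h * f y))"
      by (simp add: sum_history[OF \<omega>] g_restrict)
  qed
  also have "\<dots> = (\<Sum>h\<in>H. \<Sum>y\<in>UNIV. measure M (B h y) * (g h * f y))"
    by (simp only: Bochner_Integration.integral_sum Bochner_Integration.integrable_sum
        indicator_integral events)
  also have "\<dots> = (\<Sum>h\<in>H. measure M (A h) * (g h * transition_operator p f (h n)))"
    unfolding A_def B_def markov_chain_from_history[OF mc] transition_operator_def
    by (simp add: sum_distrib_left mult.assoc mult.left_commute)
  also have "\<dots> = (\<integral>\<omega>. (\<Sum>h\<in>H. indicator (A h) \<omega> * (g h * transition_operator p f (h n))) \<partial>M)"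
    by (simp only: Bochner_Integration.integral_sum indicator_integral events)
  also have "\<dots> = (\<integral>\<omega>. g (\<lambda>k. X k \<omega>) * transition_operator p f (X n \<omega>) \<partial>M)"
    by (rule Bochner_Integration.integral_cong[OF refl]) (simp add: sum_history g_restrict)
  finally show ?thesis .
qed

text \<open>
  The Markov property at the last step moves one application of the operator onto \<open>f\<close>; the
  induction therefore has to generalize over \<open>f\<close>.
\<close>
lemma feynman_kac_term_eq_iterate:
  fixes p :: "'s::finite \<Rightarrow> 's \<Rightarrow> real"
  assumes mc: "markov_chain_from p x (P x) X"
  shows "feynman_kac_term P X c f x n = (transition_operator (tilted_kernel c p) ^^ n) f x"
proof (induction n arbitrary: f)
  case 0
  interpret prob_space "P x"
    using mc unfolding markov_chain_from_def by simp
  have [measurable]: "X k \<in> measurable (P x) (count_space UNIV)" for k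
    using mc unfolding markov_chain_from_def by simp
  have "AE \<omega> in P x. X 0 \<omega> = x"
    using mc unfolding markov_chain_from_def by simp
  then have "(\<integral>\<omega>. f (X 0 \<omega>) \<partial>P x) = (\<integral>\<omega>. f x \<partial>P x)"
    by (intro integral_cong_AE) auto
  then show ?case
    unfolding feynman_kac_term_def by (simp add: prob_space)
next
  case (Suc n)
  have "feynman_kac_term P X c f x (Suc n)
      = (\<integral>\<omega>. exp (- (\<Sum>k<Suc n. c (X k \<omega>))) * transition_operator p f (X n \<omega>) \<partial>P x)"
    unfolding feynman_kac_term_def
    by (rule markov_property[OF mc, where g = "\<lambda>h. exp (- (\<Sum>k<Suc n. c (h k)))"]) simp
  also have "\<dots> = feynman_kac_term P X c (transition_operator (tilted_kernel c p) f) x n"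
    unfolding feynman_kac_term_def transition_operator_tilted_kernel
    by (simp add: exp_add[symmetric] mult.assoc[symmetric])
  also have "\<dots> = (transition_operator (tilted_kernel c p) ^^ Suc n) f x"
    unfolding Suc by (simp add: funpow_swap1)
  finally show ?case .
qed

section \<open>The Feynman--Kac representation\<close>

theorem mainTheorem1:
  fixes p :: "'s::finite \<Rightarrow> 's \<Rightarrow> real"
    and P :: "'s \<Rightarrow> 'w measure"
    and X :: "nat \<Rightarrow> 'w \<Rightarrow> 's"
    and \<mu> :: "'s pmf"
    and c1 :: "'s \<Rightarrow> real"
  assumes "stochastic_matrix p"
    and "0 < (MIN (x, y)\<in>UNIV. p x y)"
    and "\<forall>x. markov_chain_from p x (P x) X"
    and "invariant_distribution p \<mu>"
    and "0 < (\<Sum>x\<in>UNIV. c1 x * pmf \<mu> x)"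
  shows "\<exists>\<epsilon>0>0. \<forall>\<epsilon>. 0 < \<epsilon> \<and> \<epsilon> < \<epsilon>0 \<longrightarrow>
    (\<forall>f :: 's \<Rightarrow> real.
      let c = (\<lambda>x. \<epsilon> * c1 x);
          u = (\<lambda>x. \<Sum>n. feynman_kac_term P X c f x n)
      in (\<forall>x. summable (\<lambda>n. \<bar>feynman_kac_term P X c f x n\<bar>)) \<and>
         (\<forall>x. exp (- c x) * transition_operator p u x - u x = - f x) \<and>
         (\<forall>v. (\<forall>x. exp (- c x) * transition_operator p v x - v x = - f x) \<longrightarrow> v = u))"
proof -
  define \<delta> where "\<delta> = (MIN (x, y)\<in>UNIV. p x y)"
  have \<delta>: "0 < \<delta>" "\<delta> \<le> p x y" for x y
  proof -
    show "0 < \<delta>"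
      using assms(2) unfolding \<delta>_def .
    show "\<delta> \<le> p x y"
      unfolding \<delta>_def by (rule Min_le) (auto intro: image_eqI[where x = "(x, y)"])
  qed
  obtain h \<epsilon>0 where "0 < \<epsilon>0" and h: "\<And>\<epsilon> x. 0 < \<epsilon> \<Longrightarrow> \<epsilon> < \<epsilon>0 \<Longrightarrow>
      transition_operator (tilted_kernel (\<lambda>x. \<epsilon> * c1 x) p) (\<lambda>y. exp (\<epsilon> * h y)) x < exp (\<epsilon> * h x)"
    by (rule exists_strict_supersolution[OF assms(1,4) \<delta> assms(5)]) (rule that)
  show ?thesis
  proof (intro exI conjI allI impI)
    show "0 < \<epsilon>0" by fact
    fix \<epsilon> and f :: "'s \<Rightarrow> real"
    assume \<epsilon>: "0 < \<epsilon> \<and> \<epsilon> < \<epsilon>0"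
    define c where "c = (\<lambda>x. \<epsilon> * c1 x)"
    define u where "u = (\<lambda>x. \<Sum>n. feynman_kac_term P X c f x n)"
    let ?T = "transition_operator (tilted_kernel c p)"
    have term_eq: "feynman_kac_term P X c f x n = (?T ^^ n) f x" for x n
      using feynman_kac_term_eq_iterate assms(3) by blast
    have nonneg: "0 \<le> tilted_kernel c p x y" for x y
      using assms(1) unfolding tilted_kernel_def stochastic_matrix_def by simp
    have strict: "?T (\<lambda>y. exp (\<epsilon> * h y)) x < exp (\<epsilon> * h x)" for x
      unfolding c_def using h \<epsilon> by blast
    have equation_iff: "exp (- c x) * transition_operator p v x - v x = - f x
        \<longleftrightarrow> v x = f x + ?T v x" for v x
      unfolding transition_operator_tilted_kernel by auto
    note neumann = neumann_series[where w = "\<lambda>y. exp (\<epsilon> * h y)", OF nonneg exp_gt_zero strict]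
    have "(\<forall>x. summable (\<lambda>n. \<bar>feynman_kac_term P X c f x n\<bar>)) \<and>
        (\<forall>x. exp (- c x) * transition_operator p u x - u x = - f x) \<and>
        (\<forall>v. (\<forall>x. exp (- c x) * transition_operator p v x - v x = - f x) \<longrightarrow> v = u)"
      unfolding equation_iff unfolding u_def term_eq
      by (intro conjI allI impI neumann) (erule spec)
    then show "let c = (\<lambda>x. \<epsilon> * c1 x);
          u = (\<lambda>x. \<Sum>n. feynman_kac_term P X c f x n)
      in (\<forall>x. summable (\<lambda>n. \<bar>feynman_kac_term P X c f x n\<bar>)) \<and>
         (\<forall>x. exp (- c x) * transition_operator p u x - u x = - f x) \<and>
         (\<forall>v. (\<forall>x. exp (- c x) * transition_operator p v x - v x = - f x) \<longrightarrow> v = u)"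
      unfolding Let_def c_def u_def .
  qed
qed

end
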